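(* Let $X$ be a Banach space and $J$ a closed subspace of $X$. Then: (i) If $(X,J)$ has the quotient lifting property (QLP), then $J$ is proximinal in $X$. (ii) If $J$ is proximinal in $X$ and the metric projection $P_J$ has a linear selection, then $(X,J)$ has the QLP.
   Context: For a closed subspace $J$ of a Banach space $X$, $\pi:X\to X/J$ is the quotient map. The pair $(X,J)$ has the quotient lifting property (QLP) if for every Banach space $Y$ and every bounded linear operator $S:Y\to X/J$ there is a bounded linear operator $T:Y\to X$ with $\pi\circ T=S$ and $\|T\|=\|S\|$. The metric projection onto $J$ is the set-valued map $P_J(x)=\{j\in J:\|x-j\|=\mathrm{dist}(x,J)\}$; $J$ is proximinal if $P_J(x)\neq\emptyset$ for every $x\in X$. For a proximinal subspace $J$, a linear selection for $P_J$ is a linear map $p:X\to J$ with $p(x)\in P_J(x)$ for every $x\in X$. *)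

theory Defs
  imports "HOL-Analysis.Analysis"
begin

text \<open>
  The scalar field is a type \<open>'k::{real_normed_field, banach}\<close>, which covers exactly the real and
  the complex numbers. The ambient Banach space X is a type of class \<open>banach\<close> with a scalar
  multiplication \<open>scl :: 'k \<Rightarrow> 'a \<Rightarrow> 'a\<close> that makes it a normed space over \<open>'k\<close>
  (\<open>scl = scaleR\<close> for real scalars).

  The quotient lifting property quantifies over all Banach spaces, and formulas cannot
  quantify over types. Banach spaces are therefore also represented by records whose carrier is a
  subset of a type; operations and maps are constrained only on the carrier.
\<close>

record ('k, 'y) nspace =
  carrier :: "'y set"
  add :: "'y \<Rightarrow> 'y \<Rightarrow> 'y"
  zero :: 'y
  smult :: "'k \<Rightarrow> 'y \<Rightarrow> 'y"
  nrm :: "'y \<Rightarrow> real"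

definition ndiff :: "('k::ring_1, 'y) nspace \<Rightarrow> 'y \<Rightarrow> 'y \<Rightarrow> 'y" where
  "ndiff Y x y = add Y x (smult Y (- 1) y)"

locale banach_space =
  fixes Y :: "('k::{real_normed_field, banach}, 'y) nspace"
  assumes add_closed: "\<lbrakk>x \<in> carrier Y; y \<in> carrier Y\<rbrakk> \<Longrightarrow> add Y x y \<in> carrier Y"
    and zero_closed: "zero Y \<in> carrier Y"
    and smult_closed: "x \<in> carrier Y \<Longrightarrow> smult Y c x \<in> carrier Y"
    and add_assoc: "\<lbrakk>x \<in> carrier Y; y \<in> carrier Y; z \<in> carrier Y\<rbrakk>
      \<Longrightarrow> add Y (add Y x y) z = add Y x (add Y y z)"
    and add_commute: "\<lbrakk>x \<in> carrier Y; y \<in> carrier Y\<rbrakk> \<Longrightarrow> add Y x y = add Y y x"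
    and add_zero: "x \<in> carrier Y \<Longrightarrow> add Y x (zero Y) = x"
    and add_inverse: "x \<in> carrier Y \<Longrightarrow> \<exists>y\<in>carrier Y. add Y x y = zero Y"
    and smult_add_right: "\<lbrakk>x \<in> carrier Y; y \<in> carrier Y\<rbrakk>
      \<Longrightarrow> smult Y c (add Y x y) = add Y (smult Y c x) (smult Y c y)"
    and smult_add_left: "x \<in> carrier Y
      \<Longrightarrow> smult Y (c + d) x = add Y (smult Y c x) (smult Y d x)"
    and smult_smult: "x \<in> carrier Y \<Longrightarrow> smult Y c (smult Y d x) = smult Y (c * d) x"
    and smult_one: "x \<in> carrier Y \<Longrightarrow> smult Y 1 x = x"
    and nrm_nonneg: "x \<in> carrier Y \<Longrightarrow> 0 \<le> nrm Y x"
    and nrm_eq_zero: "x \<in> carrier Y \<Longrightarrow> nrm Y x = 0 \<longleftrightarrow> x = zero Y"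
    and nrm_smult: "x \<in> carrier Y \<Longrightarrow> nrm Y (smult Y c x) = norm c * nrm Y x"
    and nrm_triangle: "\<lbrakk>x \<in> carrier Y; y \<in> carrier Y\<rbrakk>
      \<Longrightarrow> nrm Y (add Y x y) \<le> nrm Y x + nrm Y y"
    and complete: "\<lbrakk>\<And>n::nat. s n \<in> carrier Y;
        \<And>e. 0 < e \<Longrightarrow> \<exists>N. \<forall>m\<ge>N. \<forall>n\<ge>N. nrm Y (ndiff Y (s m) (s n)) < e\<rbrakk>
      \<Longrightarrow> \<exists>l\<in>carrier Y. (\<lambda>n. nrm Y (ndiff Y (s n) l)) \<longlonglongrightarrow> 0"

definition bounded_operator ::
    "('k, 'y) nspace \<Rightarrow> ('k, 'z) nspace \<Rightarrow> ('y \<Rightarrow> 'z) \<Rightarrow> bool" where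
  "bounded_operator Y Z T \<longleftrightarrow>
     (\<forall>y\<in>carrier Y. T y \<in> carrier Z) \<and>
     (\<forall>x\<in>carrier Y. \<forall>y\<in>carrier Y. T (add Y x y) = add Z (T x) (T y)) \<and>
     (\<forall>c. \<forall>y\<in>carrier Y. T (smult Y c y) = smult Z c (T y)) \<and>
     (\<exists>C. \<forall>y\<in>carrier Y. nrm Z (T y) \<le> C * nrm Y y)"

definition operator_norm :: "('k, 'y) nspace \<Rightarrow> ('k, 'z) nspace \<Rightarrow> ('y \<Rightarrow> 'z) \<Rightarrow> real" where
  "operator_norm Y Z T = (SUP y\<in>{y \<in> carrier Y. nrm Y y \<le> 1}. nrm Z (T y))"

definition whole_space :: "('k \<Rightarrow> 'a \<Rightarrow> 'a) \<Rightarrow> ('k, 'a::real_normed_vector) nspace" where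
  "whole_space scl = \<lparr>carrier = UNIV, add = (+), zero = 0, smult = scl, nrm = norm\<rparr>"

definition quotient_projection :: "'a::real_normed_vector set \<Rightarrow> 'a \<Rightarrow> 'a set" where
  "quotient_projection J x = (\<lambda>j. x + j) ` J"

text \<open>
  The elements of X/J are the cosets of J. Adding J in the scalar multiple makes
  \<open>0 \<cdot> A\<close> the coset J rather than \<open>{0}\<close>. The norm of the coset of x is the distance of x to J.
\<close>

definition quotient_space ::
    "('k \<Rightarrow> 'a \<Rightarrow> 'a) \<Rightarrow> 'a::real_normed_vector set \<Rightarrow> ('k, 'a set) nspace" where
  "quotient_space scl J =
     \<lparr>carrier = range (quotient_projection J),
      add = (\<lambda>A B. {a + b | a b. a \<in> A \<and> b \<in> B}),
      zero = J,
      smult = (\<lambda>c A. {scl c a + j | a j. a \<in> A \<and> j \<in> J}),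
      nrm = (\<lambda>A. INF a\<in>A. norm a)\<rparr>"

text \<open>
  The property for all Banach spaces Y carried by a subset of the type \<open>'y\<close>. It holds for every Y
  of whatever size iff it holds for \<open>'y = 'a set\<close>: that type carries X/J itself, and composing a
  lifting of the identity of X/J with S lifts S.
\<close>

definition quotient_lifting_property ::
    "'y itself \<Rightarrow> ('k::{real_normed_field, banach} \<Rightarrow> 'a \<Rightarrow> 'a)
      \<Rightarrow> 'a::real_normed_vector set \<Rightarrow> bool" where
  "quotient_lifting_property _ scl J \<longleftrightarrow>
     (\<forall>(Y :: ('k, 'y) nspace) S.
        banach_space Y \<and> bounded_operator Y (quotient_space scl J) S \<longrightarrow>
        (\<exists>T. bounded_operator Y (whole_space scl) T \<and>
             (\<forall>y\<in>carrier Y. quotient_projection J (T y) = S y) \<and>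
             operator_norm Y (whole_space scl) T = operator_norm Y (quotient_space scl J) S))"

definition metric_projection :: "'a::real_normed_vector set \<Rightarrow> 'a \<Rightarrow> 'a set" where
  "metric_projection J x = {j \<in> J. norm (x - j) = infdist x J}"

definition proximinal :: "'a::real_normed_vector set \<Rightarrow> bool" where
  "proximinal J \<longleftrightarrow> (\<forall>x. metric_projection J x \<noteq> {})"

definition linear_selection ::
    "('k::field \<Rightarrow> 'a \<Rightarrow> 'a) \<Rightarrow> 'a::real_normed_vector set \<Rightarrow> ('a \<Rightarrow> 'a) \<Rightarrow> bool" where
  "linear_selection scl J p \<longleftrightarrow>
     Vector_Spaces.linear scl scl p \<and> (\<forall>x. p x \<in> metric_projection J x)"

end

theory Submission
  imports Defs
begin

text \<open>
  Write \<open>\<pi>\<close> for the quotient map. The norm of \<open>\<pi> x\<close> is \<open>infdist x J\<close>, and \<open>x - j\<close> with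
  \<open>j \<in> J\<close> runs through all representatives of the coset \<open>\<pi> x\<close>. So \<open>j\<close> is a best approximation of
  \<open>x\<close> if and only if the representative \<open>x - j\<close> of \<open>\<pi> x\<close> has the norm of \<open>\<pi> x\<close>. Both parts are
  about choosing such minimal representatives.

  For (i), lift the identity of \<open>X/J\<close>, which is a legitimate test space because it is complete
  (\<open>banach_space_quotient\<close>). The identity has norm at most 1, so its lifting \<open>T\<close> sends
  each coset to a representative of at most the same norm (\<open>nrm_le_operator_norm\<close>), and
  \<open>x - T (\<pi> x)\<close> is then a best approximation of \<open>x\<close>.

  For (ii), a linear selection \<open>p\<close> fixes every point of \<open>J\<close>, because such a point is its own only
  best approximation. Hence \<open>x - p x\<close> depends only on the coset of \<open>x\<close>, linearly, and is a
  minimal representative of it. Lifting \<open>S y\<close> to this representative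
  gives an operator \<open>T\<close> with \<open>\<parallel>T y\<parallel> = \<parallel>S y\<parallel>\<close> at every point \<open>y\<close>, so the operator norms agree.
\<close>

section \<open>The quotient of a normed space by a closed subspace\<close>

locale closed_subspace = vector_space scl
  for scl :: "'k::{real_normed_field, banach} \<Rightarrow> 'a::banach \<Rightarrow> 'a" +
  fixes J :: "'a set"
  assumes norm_scl: "norm (scl c x) = norm c * norm x"
    and subspace_J: "subspace J"
    and closed_J: "closed J"
begin

abbreviation proj :: "'a \<Rightarrow> 'a set" where "proj \<equiv> quotient_projection J"

abbreviation quot :: "('k, 'a set) nspace" where "quot \<equiv> quotient_space scl J"

lemma J_nonempty: "J \<noteq> {}"
  using subspace_0[OF subspace_J] by blast

lemma mem_proj_iff: "y \<in> proj x \<longleftrightarrow> y - x \<in> J"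
  unfolding quotient_projection_def by (auto intro!: image_eqI[where x = "y - x"])

lemma proj_eq_iff: "proj x = proj y \<longleftrightarrow> x - y \<in> J"
proof
  assume "proj x = proj y"
  moreover have "x \<in> proj x"
    using subspace_0[OF subspace_J] by (simp add: mem_proj_iff)
  ultimately show "x - y \<in> J"
    by (simp add: mem_proj_iff)
next
  assume d: "x - y \<in> J"
  have "z - x \<in> J \<longleftrightarrow> z - y \<in> J" for z
    using subspace_add[OF subspace_J _ d, of "z - x"]
      subspace_diff[OF subspace_J _ d, of "z - y"] by auto
  then show "proj x = proj y"
    by (auto simp: mem_proj_iff)
qed

lemma carrier_quot: "carrier quot = range proj"
  by (simp add: quotient_space_def)

lemma zero_quot: "zero quot = proj 0"
  by (simp add: quotient_space_def quotient_projection_def)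

lemma add_quot: "add quot (proj x) (proj y) = proj (x + y)"
proof -
  have "z \<in> proj (x + y)" if "a \<in> proj x" "b \<in> proj y" "z = a + b" for z a b
    using subspace_add[OF subspace_J, of "a - x" "b - y"] that
    by (simp add: mem_proj_iff algebra_simps)
  moreover have "\<exists>a b. z = a + b \<and> a \<in> proj x \<and> b \<in> proj y" if "z \<in> proj (x + y)" for z
    using that subspace_0[OF subspace_J]
    by (intro exI[of _ "z - y"] exI[of _ y]) (simp add: mem_proj_iff algebra_simps)
  ultimately show ?thesis
    by (auto simp: quotient_space_def)
qed

lemma smult_quot: "smult quot c (proj x) = proj (scl c x)"
proof -
  have "z \<in> proj (scl c x)" if "a \<in> proj x" "j \<in> J" "z = scl c a + j" for z a j
    using subspace_add[OF subspace_J subspace_scale[OF subspace_J, of "a - x" c] that(2)] that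
    by (simp add: mem_proj_iff scale_right_diff_distrib algebra_simps)
  moreover have "\<exists>a j. z = scl c a + j \<and> a \<in> proj x \<and> j \<in> J" if "z \<in> proj (scl c x)" for z
    using that subspace_0[OF subspace_J]
    by (intro exI[of _ x] exI[of _ "z - scl c x"]) (simp add: mem_proj_iff)
  ultimately show ?thesis
    by (auto simp: quotient_space_def)
qed

lemma ndiff_quot: "ndiff quot (proj x) (proj y) = proj (x - y)"
  by (simp add: ndiff_def smult_quot add_quot)

lemma nrm_quot: "nrm quot (proj x) = infdist x J"
proof -
  have uminus_J: "uminus ` J = J"
  proof
    show "uminus ` J \<subseteq> J"
      using subspace_neg[OF subspace_J] by auto
    then have "uminus ` uminus ` J \<subseteq> uminus ` J"
      by (rule image_mono)
    then show "J \<subseteq> uminus ` J"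
      by (simp add: image_image)
  qed
  have "nrm quot (proj x) = (INF j\<in>J. norm (x + j))"
    by (simp add: quotient_space_def quotient_projection_def image_image)
  also have "\<dots> = (INF j\<in>uminus ` J. norm (x + j))"
    by (simp only: uminus_J)
  also have "\<dots> = infdist x J"
    using J_nonempty by (simp add: infdist_def image_image dist_norm)
  finally show ?thesis .
qed

lemma nrm_quot_le: "nrm quot (proj x) \<le> norm x"
  using infdist_le[OF subspace_0[OF subspace_J], of x] by (simp add: nrm_quot)

lemma small_representative:
  assumes "nrm quot (proj x) < e"
  obtains y where "proj y = proj x" "norm y < e"
proof -
  have "(INF j\<in>J. dist x j) < e"
    using assms J_nonempty by (simp add: nrm_quot infdist_def)
  then obtain j where "j \<in> J" "dist x j < e"
    by (subst (asm) cINF_less_iff) (use J_nonempty in auto)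
  then show ?thesis
    using subspace_neg[OF subspace_J] by (intro that[of "x - j"]) (auto simp: proj_eq_iff dist_norm)
qed

lemma nrm_quot_triangle:
  "nrm quot (proj (x + y)) \<le> nrm quot (proj x) + nrm quot (proj y)"
proof (rule field_le_epsilon)
  fix e :: real
  assume "e > 0"
  then have pos: "e / 2 > 0"
    by simp
  obtain x' where x': "proj x' = proj x" "norm x' < nrm quot (proj x) + e / 2"
    by (rule small_representative[of x "nrm quot (proj x) + e / 2"]) (use pos in simp)
  obtain y' where y': "proj y' = proj y" "norm y' < nrm quot (proj y) + e / 2"
    by (rule small_representative[of y "nrm quot (proj y) + e / 2"]) (use pos in simp)
  have "proj (x + y) = proj (x' + y')"
    by (simp only: x'(1) y'(1) flip: add_quot)
  then show "nrm quot (proj (x + y)) \<le> nrm quot (proj x) + nrm quot (proj y) + e"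
    using nrm_quot_le[of "x' + y'"] norm_triangle_ineq[of x' y'] x' y' by simp
qed

lemma nrm_quot_scl: "nrm quot (proj (scl c x)) = norm c * nrm quot (proj x)"
proof (cases "c = 0")
  case True
  then show ?thesis
    using subspace_0[OF subspace_J] by (simp add: nrm_quot)
next
  case False
  \<comment> \<open>One inequality for all nonzero scalars suffices: the other one is its instance at the inverse.\<close>
  have le: "nrm quot (proj (scl d z)) \<le> norm d * nrm quot (proj z)" if "d \<noteq> 0" for d z
  proof -
    have "nrm quot (proj (scl d z)) / norm d \<le> (INF j\<in>J. dist z j)"
    proof (rule cINF_greatest[OF J_nonempty])
      fix j assume "j \<in> J"
      then have "infdist (scl d z) J \<le> norm (scl d (z - j))"
        using infdist_le[OF subspace_scale[OF subspace_J]]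
        by (simp add: scale_right_diff_distrib dist_norm)
      also have "\<dots> = norm d * norm (z - j)"
        by (rule norm_scl)
      finally show "nrm quot (proj (scl d z)) / norm d \<le> dist z j"
        using that by (simp add: nrm_quot dist_norm field_simps)
    qed
    then show ?thesis
      using that J_nonempty by (simp add: nrm_quot infdist_def field_simps)
  qed
  have "nrm quot (proj x) \<le> norm (inverse c) * nrm quot (proj (scl c x))"
    using le[of "inverse c" "scl c x"] False by simp
  then have "norm c * nrm quot (proj x) \<le> nrm quot (proj (scl c x))"
    using False by (simp add: norm_divide field_simps)
  with le[OF False, of x] show ?thesis
    by simp
qed

text \<open>
  A Cauchy sequence of cosets has a subsequence whose consecutive differences are smaller than
  \<open>2\<^sup>-\<^sup>k\<close>. Its representatives can be chosen one after the other with differences that are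
  just as small; they converge in \<open>X\<close>, and the coset of their limit is the limit sought.
\<close>

lemma quotient_complete:
  fixes x :: "nat \<Rightarrow> 'a"
  assumes cauchy: "\<And>e. 0 < e \<Longrightarrow>
    \<exists>N. \<forall>m\<ge>N. \<forall>n\<ge>N. nrm quot (proj (x m - x n)) < e"
  shows "\<exists>l. (\<lambda>n. nrm quot (proj (x n - l))) \<longlonglongrightarrow> 0"
proof -
  have "\<exists>M. \<forall>k. \<forall>m\<ge>M k. \<forall>n\<ge>M k. nrm quot (proj (x m - x n)) < (1 / 2) ^ k"
    using cauchy by (intro choice allI) simp
  then obtain M where M: "\<And>k m n. M k \<le> m \<Longrightarrow> M k \<le> n \<Longrightarrow>
      nrm quot (proj (x m - x n)) < (1 / 2) ^ k"
    by blast
  \<comment> \<open>The maximum makes the indices monotone, so that consecutive ones both lie beyond \<open>M k\<close>.\<close>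
  define r where "r k = Max (M ` {..k})" for k
  have r_ge: "M i \<le> r k" if "i \<le> k" for i k
    using that by (simp add: r_def)
  have "\<exists>u. \<forall>k. proj (u k) = proj (x (r k)) \<and> norm (u (Suc k) - u k) < (1 / 2) ^ k"
  proof (rule dependent_nat_choice)
    show "\<exists>v. proj v = proj (x (r 0))"
      by blast
  next
    fix v k
    assume v: "proj v = proj (x (r k))"
    have "nrm quot (proj (x (r (Suc k)) - x (r k))) < (1 / 2) ^ k"
      by (intro M r_ge) simp_all
    then obtain d where d: "proj d = proj (x (r (Suc k)) - x (r k))" "norm d < (1 / 2) ^ k"
      by (rule small_representative)
    have "proj (v + d) = proj (x (r (Suc k)))"
      by (metis add_quot add_diff_cancel_left' add_diff_eq v d(1))
    then show "\<exists>w. proj w = proj (x (r (Suc k))) \<and> norm (w - v) < (1 / 2) ^ k"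
      using d(2) by (intro exI[of _ "v + d"]) simp
  qed
  then obtain u where u: "\<And>k. proj (u k) = proj (x (r k))"
      "\<And>k. norm (u (Suc k) - u k) < (1 / 2) ^ k"
    by blast
  have "summable (\<lambda>k. u (Suc k) - u k)"
    by (rule summable_comparison_test'[where g = "\<lambda>k. (1 / 2) ^ k" and N = 0])
      (use u(2) in \<open>auto intro: less_imp_le summable_geometric\<close>)
  then have "convergent (\<lambda>n. \<Sum>k<n. u (Suc k) - u k)"
    by (simp add: summable_iff_convergent)
  then have "convergent (\<lambda>n. u n - u 0)"
    by (simp only: sum_lessThan_telescope)
  then obtain l0 where "(\<lambda>n. u n - u 0) \<longlonglongrightarrow> l0"
    by (auto simp: convergent_def)
  then have "(\<lambda>n. u n - u 0 + u 0) \<longlonglongrightarrow> l0 + u 0"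
    by (intro tendsto_intros)
  then obtain l where l: "u \<longlonglongrightarrow> l"
    by auto
  have "(\<lambda>n. nrm quot (proj (x n - l))) \<longlonglongrightarrow> 0"
  proof (rule LIMSEQ_I)
    fix e :: real
    assume "e > 0"
    then obtain N K where N: "\<And>m n. N \<le> m \<Longrightarrow> N \<le> n \<Longrightarrow> nrm quot (proj (x m - x n)) < e / 4"
      and K: "(1 / 2) ^ K < e / 4"
      using cauchy[of "e / 4"] real_arch_pow_inv[of "e / 4" "1 / 2"] by auto
    obtain L where L: "\<And>k. L \<le> k \<Longrightarrow> norm (u k - l) < e / 4"
      using LIMSEQ_D[OF l, of "e / 4"] \<open>e > 0\<close> by auto
    define k where "k = max K L"
    have "nrm quot (proj (x n - l)) < e" if "n \<ge> max N (r k)" for n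
    proof -
      have 1: "nrm quot (proj (x n - x (r k))) < e / 4"
      proof -
        have "nrm quot (proj (x n - x (r k))) < (1 / 2) ^ K"
          using that r_ge[of K k] by (intro M) (auto simp: k_def)
        with K show ?thesis by simp
      qed
      have "proj (x n - l) = proj ((x n - x (r k)) + (u k - l))"
        using u(1)[of k] subspace_neg[OF subspace_J, of "u k - x (r k)"]
        by (simp add: proj_eq_iff algebra_simps)
      also have "nrm quot \<dots> \<le> nrm quot (proj (x n - x (r k))) + norm (u k - l)"
        using nrm_quot_triangle[of "x n - x (r k)" "u k - l"] nrm_quot_le[of "u k - l"] by simp
      also have "\<dots> < e"
        using 1 L[of k] \<open>e > 0\<close> by (simp add: k_def)
      finally show ?thesis .
    qed
    then show "\<exists>no. \<forall>n\<ge>no. norm (nrm quot (proj (x n - l)) - 0) < e"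
      by (intro exI[of _ "max N (r k)"]) (auto simp: nrm_quot infdist_nonneg)
  qed
  then show ?thesis ..
qed

lemma banach_space_quotient: "banach_space quot"
proof
  show "zero quot \<in> carrier quot"
    by (simp add: zero_quot carrier_quot)
next
  fix A and c d :: 'k
  assume "A \<in> carrier quot"
  then obtain x where A: "A = proj x"
    by (auto simp: carrier_quot)
  show "smult quot c A \<in> carrier quot"
    by (simp add: A smult_quot carrier_quot)
  show "add quot A (zero quot) = A"
    by (simp add: A zero_quot add_quot)
  have "add quot A (proj (- x)) = zero quot"
    by (simp add: A add_quot zero_quot)
  then show "\<exists>B\<in>carrier quot. add quot A B = zero quot"
    by (auto simp: carrier_quot)
  show "smult quot (c + d) A = add quot (smult quot c A) (smult quot d A)"
    by (simp add: A smult_quot add_quot scale_left_distrib)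
  show "smult quot c (smult quot d A) = smult quot (c * d) A"
    by (simp add: A smult_quot)
  show "smult quot 1 A = A"
    by (simp add: A smult_quot)
  show "0 \<le> nrm quot A"
    by (simp add: A nrm_quot infdist_nonneg)
  \<comment> \<open>Closedness of \<open>J\<close> enters here: a coset of norm 0 has its points at distance 0 from \<open>J\<close>.\<close>
  show "nrm quot A = 0 \<longleftrightarrow> A = zero quot"
    using in_closed_iff_infdist_zero[OF closed_J J_nonempty, of x]
    by (simp add: A zero_quot nrm_quot proj_eq_iff)
  show "nrm quot (smult quot c A) = norm c * nrm quot A"
    by (simp add: A smult_quot nrm_quot_scl)
next
  fix A B and c :: 'k
  assume "A \<in> carrier quot" "B \<in> carrier quot"
  then obtain x y where AB: "A = proj x" "B = proj y"
    by (auto simp: carrier_quot)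
  show "add quot A B \<in> carrier quot"
    by (simp add: AB add_quot carrier_quot)
  show "add quot A B = add quot B A"
    by (simp only: AB add_quot add.commute[of x y])
  show "smult quot c (add quot A B) = add quot (smult quot c A) (smult quot c B)"
    by (simp add: AB smult_quot add_quot scale_right_distrib)
  show "nrm quot (add quot A B) \<le> nrm quot A + nrm quot B"
    by (simp add: AB add_quot nrm_quot_triangle)
next
  fix A B C
  assume "A \<in> carrier quot" "B \<in> carrier quot" "C \<in> carrier quot"
  then obtain x y z where "A = proj x" "B = proj y" "C = proj z"
    by (auto simp: carrier_quot)
  then show "add quot (add quot A B) C = add quot A (add quot B C)"
    by (simp add: add_quot add.assoc)
next
  fix s :: "nat \<Rightarrow> 'a set"
  assume s: "\<And>n. s n \<in> carrier quot"
    and cauchy: "\<And>e. 0 < e \<Longrightarrow>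
      \<exists>N. \<forall>m\<ge>N. \<forall>n\<ge>N. nrm quot (ndiff quot (s m) (s n)) < e"
  from s obtain x where x: "\<And>n. s n = proj (x n)"
    unfolding carrier_quot image_iff by metis
  obtain l where "(\<lambda>n. nrm quot (proj (x n - l))) \<longlonglongrightarrow> 0"
    using quotient_complete[of x] cauchy by (auto simp: x ndiff_quot)
  then show "\<exists>l\<in>carrier quot. (\<lambda>n. nrm quot (ndiff quot (s n) l)) \<longlonglongrightarrow> 0"
    by (auto simp: x ndiff_quot carrier_quot)
qed

end

section \<open>The operator norm\<close>

text \<open>
  The operator norm is a supremum over the unit ball; homogeneity extends its bound to the
  whole space. Rescaling uses the embedding of the reals into the scalar field.
\<close>

lemma nrm_le_operator_norm:
  fixes Y :: "('k::{real_normed_field, banach}, 'y) nspace"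
  assumes Y: "banach_space Y"
    and T: "bounded_operator Y (whole_space scl) T"
    and norm_scl: "\<And>c x. norm (scl c x) = norm c * norm x"
    and y: "y \<in> carrier Y"
  shows "norm (T y) \<le> operator_norm Y (whole_space scl) T * nrm Y y"
proof -
  interpret banach_space Y by (rule Y)
  have "\<exists>C. \<forall>z\<in>carrier Y. norm (T z) \<le> C * nrm Y z"
    using T by (simp add: bounded_operator_def whole_space_def)
  then obtain C where C: "\<And>z. z \<in> carrier Y \<Longrightarrow> norm (T z) \<le> C * nrm Y z"
    by blast
  show ?thesis
  proof (cases "nrm Y y = 0")
    case True
    then show ?thesis
      using C[OF y] by simp
  next
    case False
    with nrm_nonneg[OF y] have pos: "nrm Y y > 0"
      by simp
    define c :: 'k where "c = of_real (inverse (nrm Y y))"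
    have norm_c: "norm c = inverse (nrm Y y)"
      using pos unfolding c_def by (subst norm_of_real) simp
    let ?B = "{y \<in> carrier Y. nrm Y y \<le> 1}"
    have "bdd_above ((\<lambda>z. norm (T z)) ` ?B)"
    proof (rule bdd_aboveI2)
      fix z assume z: "z \<in> ?B"
      have "norm (T z) \<le> C * nrm Y z"
        using C z by simp
      also have "\<dots> \<le> \<bar>C\<bar> * 1"
        using z nrm_nonneg[of z] by (intro mult_mono) auto
      finally show "norm (T z) \<le> \<bar>C\<bar>" by simp
    qed
    moreover have "smult Y c y \<in> ?B"
      using y pos by (simp add: smult_closed nrm_smult norm_c)
    ultimately have "norm (T (smult Y c y)) \<le> (SUP z\<in>?B. norm (T z))"
      by (intro cSUP_upper)
    then have "norm (T (smult Y c y)) \<le> operator_norm Y (whole_space scl) T"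
      by (simp add: operator_norm_def whole_space_def)
    moreover have "T (smult Y c y) = scl c (T y)"
      using T y by (simp add: bounded_operator_def whole_space_def)
    ultimately show ?thesis
      using pos by (simp add: norm_scl norm_c field_simps)
  qed
qed

section \<open>Lifting and best approximation\<close>

context closed_subspace
begin

lemma proximinal_if_quotient_lifting_property:
  assumes "quotient_lifting_property TYPE('a set) scl J"
  shows "proximinal J"
proof -
  have "bounded_operator quot quot (\<lambda>A. A)"
    by (auto simp: bounded_operator_def intro!: exI[of _ 1])
  then obtain T where T: "bounded_operator quot (whole_space scl) T"
    and lift: "\<And>A. A \<in> carrier quot \<Longrightarrow> proj (T A) = A"
    and norm_T: "operator_norm quot (whole_space scl) T = operator_norm quot quot (\<lambda>A. A)"
    using assms[unfolded quotient_lifting_property_def,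
        THEN spec, of quot, THEN spec, of "\<lambda>A. A", THEN mp] banach_space_quotient by auto
  have "proj 0 \<in> {A \<in> carrier quot. nrm quot A \<le> 1}"
    using nrm_quot_le[of 0] by (simp add: carrier_quot)
  then have "operator_norm quot quot (\<lambda>A. A) \<le> 1"
    unfolding operator_norm_def by (intro cSUP_least) auto
  then have T_le: "norm (T (proj x)) \<le> nrm quot (proj x)" for x
    using nrm_le_operator_norm[OF banach_space_quotient T norm_scl, of "proj x"]
      mult_right_mono[of "operator_norm quot quot (\<lambda>A. A)" 1 "nrm quot (proj x)"]
    by (simp add: norm_T carrier_quot nrm_quot infdist_nonneg)
  have "x - T (proj x) \<in> metric_projection J x" for x
  proof -
    have "proj x = proj (T (proj x))"
      using lift[of "proj x"] by (simp add: carrier_quot)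
    moreover have "infdist x J \<le> norm (T (proj x))"
      using nrm_quot_le[of "T (proj x)"] by (metis calculation nrm_quot)
    ultimately show ?thesis
      using T_le[of x] by (simp add: metric_projection_def proj_eq_iff nrm_quot)
  qed
  then show ?thesis
    unfolding proximinal_def by blast
qed

lemma quotient_lifting_property_if_linear_selection:
  assumes "linear_selection scl J p"
  shows "quotient_lifting_property TYPE('y) scl J"
  unfolding quotient_lifting_property_def
proof (intro allI impI, elim conjE)
  fix Y :: "('k, 'y) nspace" and S
  assume Y: "banach_space Y" and S: "bounded_operator Y quot S"
  interpret p: Vector_Spaces.linear scl scl p
    using assms by (simp add: linear_selection_def)
  have p_J: "p x \<in> J" and norm_p: "norm (x - p x) = infdist x J" for x
    using assms by (auto simp: linear_selection_def metric_projection_def)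
  have p_fixes: "p j = j" if "j \<in> J" for j
    using norm_p[of j] that by simp
  define q where "q x = x - p x" for x
  have q_cong: "q x = q y" if "proj x = proj y" for x y
    using p_fixes[of "x - y"] that by (simp add: q_def proj_eq_iff p.diff algebra_simps)
  have q_add: "q (x + y) = q x + q y" and q_scl: "q (scl c x) = scl c (q x)" for x y c
    by (simp_all add: q_def p.add p.scale scale_right_diff_distrib)
  have proj_q: "proj (q x) = proj x" for x
    using p_J subspace_neg[OF subspace_J] by (simp add: q_def proj_eq_iff)
  have norm_q: "norm (q x) = nrm quot (proj x)" for x
    by (simp add: q_def norm_p nrm_quot)
  define rep where "rep y = (SOME x. proj x = S y)" for y
  have rep: "proj (rep y) = S y" if "y \<in> carrier Y" for y
  proof -
    have "\<exists>x. proj x = S y"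
      using S that by (force simp: bounded_operator_def carrier_quot)
    then show ?thesis
      unfolding rep_def by (rule someI_ex)
  qed
  define T where "T y = q (rep y)" for y
  have T_eq: "T y = q x" if "y \<in> carrier Y" "S y = proj x" for x y
    unfolding T_def using that rep by (intro q_cong) simp
  have norm_T: "norm (T y) = nrm quot (S y)" if "y \<in> carrier Y" for y
    using rep[OF that] norm_q[of "rep y"] by (simp add: T_def)
  interpret Y: banach_space Y by (rule Y)
  have "T (add Y x y) = T x + T y" if "x \<in> carrier Y" "y \<in> carrier Y" for x y
  proof -
    have "S (add Y x y) = proj (rep x + rep y)"
      using S that rep by (simp add: bounded_operator_def flip: add_quot)
    then show ?thesis
      using T_eq[OF Y.add_closed[OF that]] q_add by (simp add: T_def)
  qed
  moreover have "T (smult Y c y) = scl c (T y)" if "y \<in> carrier Y" for c y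
  proof -
    have "S (smult Y c y) = proj (scl c (rep y))"
      using S that rep by (simp add: bounded_operator_def flip: smult_quot)
    then show ?thesis
      using T_eq[OF Y.smult_closed[OF that]] q_scl by (simp add: T_def)
  qed
  moreover have "\<exists>C. \<forall>y\<in>carrier Y. norm (T y) \<le> C * nrm Y y"
    using S norm_T by (simp add: bounded_operator_def)
  ultimately have "bounded_operator Y (whole_space scl) T"
    by (simp add: bounded_operator_def whole_space_def)
  moreover have "\<forall>y\<in>carrier Y. proj (T y) = S y"
    using rep by (simp add: T_def proj_q)
  moreover have "operator_norm Y (whole_space scl) T = operator_norm Y quot S"
    unfolding operator_norm_def
    by (rule SUP_cong) (simp_all add: norm_T whole_space_def)
  ultimately show "\<exists>T. bounded_operator Y (whole_space scl) T \<and>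
      (\<forall>y\<in>carrier Y. proj (T y) = S y) \<and>
      operator_norm Y (whole_space scl) T = operator_norm Y quot S"
    by blast
qed

end

theorem theorem6:
  fixes scl :: "'k::{real_normed_field, banach} \<Rightarrow> 'a::banach \<Rightarrow> 'a"
    and J :: "'a set"
  assumes "vector_space scl"
    and "\<And>c x. norm (scl c x) = norm c * norm x"
    and "module.subspace scl J"
    and "closed J"
  shows "(quotient_lifting_property TYPE('a set) scl J \<longrightarrow> proximinal J) \<and>
         (proximinal J \<and> (\<exists>p. linear_selection scl J p) \<longrightarrow>
            quotient_lifting_property TYPE('y) scl J)"
proof -
  interpret closed_subspace scl J
    using assms by (intro closed_subspace.intro closed_subspace_axioms.intro) auto
  show ?thesis
    using proximinal_if_quotient_lifting_property
      quotient_lifting_property_if_linear_selection by blast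
qed

end
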